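(* Let $\mu$ be a nontrivial probability measure on $\partial\mathbb{D}$ and let $z_0$ be an isolated point of $\operatorname{supp}(d\mu)$. Then there exist $C>0$ and $a>0$ and, for each $n\ge1$, a zero $z_n$ of $\Phi_n(z;d\mu)$ so that $$|z_n-z_0|\le Ce^{-a|n|}.$$
   Context: $\mathbb{D}=\{|z|<1\}$. A probability measure on $\partial\mathbb{D}$ is nontrivial if it is not a finite combination of delta functions. $\Phi_n(z;d\mu)$ is the monic orthogonal polynomial of degree $n$ in $L^2(\partial\mathbb{D},d\mu)$. *)

theory Defs
  imports "HOL-Probability.Probability" "HOL-Computational_Algebra.Polynomial"
begin

definition circle_prob_measure :: "complex measure \<Rightarrow> bool" where
  "circle_prob_measure \<mu> \<longleftrightarrow>
     prob_space \<mu> \<and> sets \<mu> = sets (restrict_space borel (sphere 0 1))"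

text \<open>A finite combination of point masses; \<open>return \<mu> z\<close> is the Dirac measure at \<open>z\<close> on the
  \<open>\<sigma>\<close>-algebra of \<open>\<mu>\<close>.\<close>

definition finite_delta_combination :: "complex measure \<Rightarrow> bool" where
  "finite_delta_combination \<mu> \<longleftrightarrow>
     (\<exists>F c. finite F \<and> F \<subseteq> space \<mu> \<and>
        (\<forall>A\<in>sets \<mu>. emeasure \<mu> A = (\<Sum>z\<in>F. c z * emeasure (return \<mu> z) A)))"

definition nontrivial_circle_measure :: "complex measure \<Rightarrow> bool" where
  "nontrivial_circle_measure \<mu> \<longleftrightarrow> circle_prob_measure \<mu> \<and> \<not> finite_delta_combination \<mu>"

definition measure_supp :: "complex measure \<Rightarrow> complex set" where
  "measure_supp \<mu> = {x \<in> space \<mu>. \<forall>U. open U \<longrightarrow> x \<in> U \<longrightarrow> emeasure \<mu> (U \<inter> space \<mu>) > 0}"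

definition monic_orthogonal :: "complex measure \<Rightarrow> nat \<Rightarrow> complex poly \<Rightarrow> bool" where
  "monic_orthogonal \<mu> n p \<longleftrightarrow>
     degree p = n \<and> lead_coeff p = 1 \<and>
     (\<forall>q. degree q < n \<longrightarrow> (LINT z|\<mu>. cnj (poly q z) * poly p z) = 0)"

text \<open>Well defined for nontrivial \<open>\<mu>\<close>, see \<open>ex1_monic_orthogonal\<close> below.\<close>

definition opuc :: "complex measure \<Rightarrow> nat \<Rightarrow> complex poly" where
  "opuc \<mu> n = (THE p. monic_orthogonal \<mu> n p)"

context
  fixes \<mu> :: "complex measure"
  assumes nontriv: "nontrivial_circle_measure \<mu>"
begin

private lemma sets_mu: "sets \<mu> = sets (restrict_space borel (sphere 0 1))"
  using nontriv by (simp add: nontrivial_circle_measure_def circle_prob_measure_def)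

private lemma prob_mu: "prob_space \<mu>"
  using nontriv by (simp add: nontrivial_circle_measure_def circle_prob_measure_def)

private lemma space_mu: "space \<mu> = sphere 0 1"
  using sets_eq_imp_space_eq[OF sets_mu] by (simp add: space_restrict_space)

private lemma integrable_continuous:
  fixes f :: "complex \<Rightarrow> complex"
  assumes "continuous_on (sphere 0 1) f"
  shows "integrable \<mu> f"
proof -
  interpret prob_space \<mu> by (rule prob_mu)
  have "f \<in> borel_measurable \<mu>"
    using borel_measurable_continuous_on_restrict[OF assms]
    by (simp add: measurable_cong_sets[OF sets_mu refl])
  moreover have "compact (f ` sphere 0 1)"
    using assms by (intro compact_continuous_image) auto
  then obtain B where "\<And>x. x \<in> sphere 0 1 \<Longrightarrow> norm (f x) \<le> B"
    using compact_imp_bounded bounded_iff by (metis imageI)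
  ultimately show ?thesis
    by (intro integrable_const_bound[of _ B]) (auto simp: space_mu)
qed

private definition ip :: "complex poly \<Rightarrow> complex poly \<Rightarrow> complex" where
  "ip q p = (LINT z|\<mu>. cnj (poly q z) * poly p z)"

private lemma integrable_ip: "integrable \<mu> (\<lambda>z. cnj (poly q z) * poly p z)"
  by (intro integrable_continuous continuous_intros)

private lemma ip_diff_smult: "ip q (p - smult c r) = ip q p - c * ip q r"
proof -
  have "ip q (p - smult c r)
      = (LINT z|\<mu>. cnj (poly q z) * poly p z - c * (cnj (poly q z) * poly r z))"
    by (simp add: ip_def algebra_simps)
  then show ?thesis
    by (simp add: ip_def integrable_ip)
qed

private lemma ip_add_smult_left: "ip (smult c q + s) p = cnj c * ip q p + ip s p"
proof -
  have "ip (smult c q + s) p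
      = (LINT z|\<mu>. cnj c * (cnj (poly q z) * poly p z) + cnj (poly s z) * poly p z)"
    by (simp add: ip_def algebra_simps)
  then show ?thesis
    by (simp add: ip_def integrable_ip)
qed

private lemma ip_self_nonzero:
  assumes "p \<noteq> 0"
  shows "ip p p \<noteq> 0"
proof
  interpret prob_space \<mu> by (rule prob_mu)
  assume "ip p p = 0"
  moreover have "ip p p = (LINT z|\<mu>. complex_of_real ((norm (poly p z))\<^sup>2))"
    unfolding ip_def
    by (intro Bochner_Integration.integral_cong refl) (simp add: complex_norm_square mult.commute del: of_real_power)
  moreover have "\<dots> = complex_of_real (LINT z|\<mu>. (norm (poly p z))\<^sup>2)"
    by (rule integral_complex_of_real)
  ultimately have 0: "(LINT z|\<mu>. (norm (poly p z))\<^sup>2) = 0"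
    by simp
  have "integrable \<mu> (\<lambda>z. complex_of_real ((norm (poly p z))\<^sup>2))"
    by (intro integrable_continuous continuous_intros)
  then have "integrable \<mu> (\<lambda>z. (norm (poly p z))\<^sup>2)"
    by (simp only: complex_of_real_integrable_eq)
  then have "AE z in \<mu>. (norm (poly p z))\<^sup>2 = 0"
    using 0 by (subst (asm) integral_nonneg_eq_0_iff_AE) auto
  then have AE: "AE z in \<mu>. poly p z = 0"
    by simp
  define F where "F = {z \<in> space \<mu>. poly p z = 0}"
  have F: "finite F" "F \<subseteq> space \<mu>"
    using poly_roots_finite[OF assms] by (auto simp: F_def)
  have sing: "{z} \<in> sets \<mu>" if "z \<in> F" for z
  proof -
    have "{z} = sphere 0 1 \<inter> {z}"
      using that F(2) by (auto simp: space_mu)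
    then show ?thesis
      unfolding sets_mu sets_restrict_space by (metis borel_singleton imageI sets.empty_sets)
  qed
  have "emeasure \<mu> A = (\<Sum>z\<in>F. emeasure \<mu> {z} * emeasure (return \<mu> z) A)"
    if A: "A \<in> sets \<mu>" for A
  proof -
    have FA: "A \<inter> F \<in> sets \<mu>"
    proof (rule sets.countable)
      show "countable (A \<inter> F)"
        using F(1) by (intro countable_finite) simp
    qed (use sing in blast)
    have "AE z in \<mu>. z \<in> A \<longleftrightarrow> z \<in> A \<inter> F"
      using AE AE_space by eventually_elim (simp add: F_def)
    then have "emeasure \<mu> A = emeasure \<mu> (A \<inter> F)"
      using A FA by (rule emeasure_eq_AE)
    also have "\<dots> = (\<Sum>z\<in>A \<inter> F. emeasure \<mu> {z})"
    proof (rule emeasure_eq_sum_singleton)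
      show "finite (A \<inter> F)"
        using F(1) by simp
    qed (use sing in blast)
    also have "\<dots> = (\<Sum>z\<in>F. emeasure \<mu> {z} * emeasure (return \<mu> z) A)"
    proof (rule sum.mono_neutral_cong_left)
      show "emeasure \<mu> {z} = emeasure \<mu> {z} * emeasure (return \<mu> z) A" if "z \<in> A \<inter> F" for z
        using that A by simp
    qed (use F(1) A in \<open>auto simp: indicator_def\<close>)
    finally show ?thesis .
  qed
  then have "finite_delta_combination \<mu>"
    unfolding finite_delta_combination_def
    by (intro exI[of _ F] exI[of _ "\<lambda>z. emeasure \<mu> {z}"] conjI ballI F)
  then show False
    using nontriv by (simp add: nontrivial_circle_measure_def)
qed

private lemma ex_orthogonal_below:
  assumes "m \<le> n"
  shows "\<exists>p. degree p = n \<and> lead_coeff p = 1 \<and> (\<forall>q. (\<forall>i\<ge>m. coeff q i = 0) \<longrightarrow> ip q p = 0)"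
  using assms
proof (induction m arbitrary: n)
  case 0
  show ?case
  proof (intro exI[of _ "monom 1 n"] conjI allI impI)
    fix q :: "complex poly" assume "\<forall>i\<ge>0. coeff q i = 0"
    then have "q = 0" by (simp add: poly_eq_iff)
    then show "ip q (monom 1 n) = 0" by (simp add: ip_def)
  qed (simp_all add: degree_monom_eq)
next
  case (Suc m)
  obtain p where p: "degree p = n" "lead_coeff p = 1"
      "\<And>q. (\<forall>i\<ge>m. coeff q i = 0) \<Longrightarrow> ip q p = 0"
    using Suc.IH[of n] Suc.prems by auto
  obtain r where r: "degree r = m" "lead_coeff r = 1"
      "\<And>q. (\<forall>i\<ge>m. coeff q i = 0) \<Longrightarrow> ip q r = 0"
    using Suc.IH[of m] by auto
  have r0: "ip r r \<noteq> 0" using r(2) by (intro ip_self_nonzero) auto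
  define c where "c = ip r p / ip r r"
  let ?p = "p - smult c r"
  have hi: "coeff r i = 0" if "i > m" for i
    using that r(1) by (simp add: coeff_eq_0)
  have "coeff ?p n = 1"
    using p hi[of n] Suc.prems by simp
  moreover have "degree ?p \<le> n"
    using p r Suc.prems by (intro degree_diff_le) (auto intro: order.trans[OF degree_smult_le])
  ultimately have deg: "degree ?p = n" "lead_coeff ?p = 1"
    using le_degree[of ?p n] by auto
  have "ip q ?p = 0" if q: "\<forall>i\<ge>Suc m. coeff q i = 0" for q
  proof -
    define s where "s = q - smult (coeff q m) r"
    have s: "\<forall>i\<ge>m. coeff s i = 0"
    proof (intro allI impI)
      fix i assume "i \<ge> m"
      then show "coeff s i = 0"
        using q r hi[of i] by (cases "i = m") (auto simp: s_def)
    qed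
    have "ip q ?p = ip (smult (coeff q m) r + s) ?p"
      by (simp add: s_def)
    also have "\<dots> = 0"
      using r0 p(3)[OF s] r(3)[OF s]
      by (simp add: ip_add_smult_left ip_diff_smult c_def)
    finally show ?thesis .
  qed
  with deg show ?case by blast
qed

lemma ex1_monic_orthogonal: "\<exists>!p. monic_orthogonal \<mu> n p"
proof (rule ex_ex1I)
  obtain p where p: "degree p = n" "lead_coeff p = 1"
      "\<And>q. (\<forall>i\<ge>n. coeff q i = 0) \<Longrightarrow> ip q p = 0"
    using ex_orthogonal_below[OF order_refl] by blast
  have "ip q p = 0" if "degree q < n" for q
    using that by (intro p(3)) (simp add: coeff_eq_0)
  with p(1,2) have "monic_orthogonal \<mu> n p"
    unfolding monic_orthogonal_def by (simp add: ip_def)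
  then show "\<exists>p. monic_orthogonal \<mu> n p" ..
next
  fix p r assume p: "monic_orthogonal \<mu> n p" and r: "monic_orthogonal \<mu> n r"
  show "p = r"
  proof (rule ccontr)
    assume "p \<noteq> r"
    define d where "d = p - r"
    have d: "d \<noteq> 0" using \<open>p \<noteq> r\<close> by (simp add: d_def)
    have pr: "degree p = n" "lead_coeff p = 1" "degree r = n" "lead_coeff r = 1"
        "\<And>q. degree q < n \<Longrightarrow> ip q p = 0" "\<And>q. degree q < n \<Longrightarrow> ip q r = 0"
      using p r unfolding monic_orthogonal_def ip_def by blast+
    have "degree d \<le> n"
      unfolding d_def using pr(1,3) by (intro degree_diff_le) simp_all
    have "coeff d n = 0"
      using pr(2,4) unfolding pr(1,3) d_def by simp
    have "degree d \<noteq> n"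
    proof
      assume "degree d = n"
      with \<open>coeff d n = 0\<close> have "lead_coeff d = 0"
        by simp
      with d show False
        by (simp only: leading_coeff_0_iff)
    qed
    with \<open>degree d \<le> n\<close> have dn: "degree d < n"
      by (rule le_neq_implies_less)
    have "ip d d = ip d (p - smult 1 r)"
      by (simp only: d_def smult_1_left)
    also have "\<dots> = ip d p - 1 * ip d r"
      by (rule ip_diff_smult)
    also have "\<dots> = 0"
      by (simp only: pr(5)[OF dn] pr(6)[OF dn] mult_zero_right diff_zero)
    finally show False
      using ip_self_nonzero[OF d] by (rule notE[rotated])
  qed
qed

lemma monic_orthogonal_opuc: "monic_orthogonal \<mu> n (opuc \<mu> n)"
  unfolding opuc_def by (rule theI'[OF ex1_monic_orthogonal])

end

end

theory Submission
  imports Defs "HOL-Computational_Algebra.Fundamental_Theorem_Algebra"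
    "HOL-Real_Asymp.Real_Asymp"
begin

text \<open>Write \<open>p\<close> for the \<open>n\<close>-th orthogonal polynomial, \<open>\<beta>\<close> for the mass of \<open>z0\<close> and \<open>\<nu>\<close> for the rest
  of \<open>\<mu>\<close>. Testing \<open>p\<close> against a polynomial \<open>q\<close> with \<open>q(z0) = 1\<close> that is exponentially small on the
  support of \<open>\<nu>\<close> shows that \<open>p(z0)\<close> is exponentially small relative to the norm of \<open>p\<close> in
  \<open>L\<^sup>2(\<nu>)\<close>. Testing against \<open>r = (p - p(z0) q) / (z - z0)\<close>, and using that \<open>1 / (cnj u - 1)\<close>
  has real part \<open>-1/2\<close> on the unit circle, shows that \<open>\<beta> |r(z0)| |p(z0)|\<close> is at least a quarter of
  the square of this norm. As \<open>r(z0) = p'(z0) - p(z0) q'(z0)\<close>, the logarithmic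
  derivative \<open>p' / p = (\<Sum>w. 1 / (z - w))\<close>, the sum running over the zeros, is exponentially large
  at \<open>z0\<close>, which forces a zero exponentially close to \<open>z0\<close>.\<close>

section \<open>The logarithmic derivative and the nearest zero\<close>

text \<open>In \<open>p' / p = sum of 1 / (z - w)\<close>, taken over the zeros with multiplicity,
  each term has modulus at most \<open>1 / d\<close>. The form without denominators also covers
  zeros at \<open>z\<close> and constant polynomials, and it passes through an induction that splits
  off one linear factor at a time.\<close>

lemma pderiv_le_of_roots_far:
  fixes p :: "complex poly"
  assumes "\<And>w. poly p w = 0 \<Longrightarrow> d \<le> cmod (z - w)"
  shows "cmod (poly (pderiv p) z) * d \<le> degree p * cmod (poly p z)"
  using assms
proof (induction "degree p" arbitrary: p)
  case 0
  then obtain c where "p = [:c:]"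
    by (metis degree_eq_zeroE)
  then show ?case
    by simp
next
  case (Suc n)
  have "\<not> constant (poly p)"
    using Suc.hyps(2) by (simp add: constant_degree)
  then obtain w where w: "poly p w = 0"
    using fundamental_theorem_of_algebra by blast
  then obtain q where pq: "p = [:-w, 1:] * q"
    by (auto simp: poly_eq_0_iff_dvd)
  have "q \<noteq> 0"
    using Suc.hyps(2) pq by auto
  then have n: "n = degree q"
    using Suc.hyps(2) unfolding pq by (subst (asm) degree_mult_eq) auto
  have IH: "cmod (poly (pderiv q) z) * d \<le> n * cmod (poly q z)"
    using Suc.hyps(1)[OF n] Suc.prems n by (simp add: pq)
  have d: "d \<le> cmod (z - w)"
    using Suc.prems w by blast
  show ?case
  \<comment> \<open>The estimates in the second case multiply inequalities by \<open>d\<close>,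
    which must be nonnegative there.\<close>
  proof (cases "d \<le> 0")
    case True
    then have "cmod (poly (pderiv p) z) * d \<le> 0"
      by (simp add: mult_nonneg_nonpos)
    also have "0 \<le> degree p * cmod (poly p z)"
      by simp
    finally show ?thesis .
  next
    case False
    have "poly (pderiv p) z = (z - w) * poly (pderiv q) z + poly q z"
      unfolding pq pderiv_mult by (simp add: pderiv_pCons algebra_simps)
    then have "cmod (poly (pderiv p) z) \<le> cmod (z - w) * cmod (poly (pderiv q) z) + cmod (poly q z)"
      by (metis norm_mult norm_triangle_ineq)
    then have "cmod (poly (pderiv p) z) * d
        \<le> (cmod (z - w) * cmod (poly (pderiv q) z) + cmod (poly q z)) * d"
      using False by (intro mult_right_mono) auto
    also have "\<dots> = cmod (z - w) * (cmod (poly (pderiv q) z) * d) + d * cmod (poly q z)"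
      by (simp add: algebra_simps)
    also have "\<dots> \<le> cmod (z - w) * (n * cmod (poly q z)) + cmod (z - w) * cmod (poly q z)"
      using IH d by (intro add_mono mult_left_mono mult_right_mono) auto
    also have "\<dots> = Suc n * (cmod (z - w) * cmod (poly q z))"
      by (simp add: algebra_simps)
    also have "cmod (z - w) * cmod (poly q z) = cmod (poly p z)"
      by (simp add: pq norm_mult[symmetric] algebra_simps)
    finally show ?thesis
      using Suc.hyps(2) by simp
  qed
qed

text \<open>The zero nearest to \<open>z\<close> works: its distance is an admissible
  \<open>d\<close> in the previous bound.\<close>

lemma ex_root_near:
  fixes p :: "complex poly"
  assumes "degree p > 0"
  shows "\<exists>w. poly p w = 0 \<and>
           cmod (poly (pderiv p) z) * cmod (z - w) \<le> degree p * cmod (poly p z)"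
proof -
  let ?R = "{w. poly p w = 0}"
  have "\<not> constant (poly p)"
    using assms by (simp add: constant_degree)
  then have "?R \<noteq> {}"
    using fundamental_theorem_of_algebra by blast
  moreover have "finite ?R"
    using assms by (intro poly_roots_finite) auto
  ultimately obtain w where "w \<in> ?R" "\<And>v. v \<in> ?R \<Longrightarrow> cmod (z - w) \<le> cmod (z - v)"
    using ex_min_if_finite[of "(\<lambda>w. cmod (z - w)) ` ?R"] by (force simp: not_less)
  then show ?thesis
    using pderiv_le_of_roots_far[of p "cmod (z - w)" z] by blast
qed

section \<open>Auxiliary facts on the circle and on integrals\<close>

text \<open>The map \<open>1 / (v - 1)\<close> takes the unit circle without 1 to the line with real
  part -1/2, because \<open>|v - 1|^2 = 2 * (1 - Re v)\<close> there. The conjugate is present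
  because the factor \<open>z - z0\<close> is later divided out of a conjugated polynomial.\<close>

lemma Re_one_over_cnj_minus_one:
  assumes "cmod u = 1" "u \<noteq> 1"
  shows "Re (1 / (cnj u - 1)) = - 1 / 2"
proof -
  have 1: "(Re u)\<^sup>2 + (Im u)\<^sup>2 = 1"
    using assms(1) by (metis cmod_power2 one_power2)
  have "Re u \<noteq> 1"
    using 1 assms(2) by (auto simp: complex_eq_iff)
  moreover have "(Re u - 1)\<^sup>2 + (Im u)\<^sup>2 = 2 * (1 - Re u)"
    using 1 by (simp add: power2_eq_square algebra_simps)
  ultimately show ?thesis
    by (simp add: Re_divide field_simps)
qed

text \<open>Expand the nonnegative integral of \<open>(f x - ?m)^2\<close>. Total mass below 1 is
  allowed, since the lemma is applied to a probability measure with an atom removed.\<close>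

lemma (in finite_measure) square_integral_le:
  fixes f :: "'a \<Rightarrow> real"
  assumes "integrable M f" "integrable M (\<lambda>x. (f x)\<^sup>2)" "measure M (space M) \<le> 1"
  shows "(integral\<^sup>L M f)\<^sup>2 \<le> (LINT x|M. (f x)\<^sup>2)"
proof -
  let ?m = "integral\<^sup>L M f"
  have "0 \<le> (LINT x|M. (f x - ?m)\<^sup>2)"
    by simp
  also have "\<dots> = (LINT x|M. (f x)\<^sup>2 - (2 * ?m) * f x + ?m\<^sup>2)"
    by (simp add: power2_eq_square algebra_simps)
  also have "\<dots> = (LINT x|M. (f x)\<^sup>2) - 2 * ?m * ?m + measure M (space M) * ?m\<^sup>2"
    using assms by simp
  also have "\<dots> \<le> (LINT x|M. (f x)\<^sup>2) - 2 * ?m * ?m + 1 * ?m\<^sup>2"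
    using assms by (intro add_left_mono mult_right_mono) auto
  finally show ?thesis
    by (simp add: power2_eq_square)
qed

text \<open>A continuous function is bounded on the compact circle. Asking for the circle only
  almost everywhere lets the lemma serve both \<mu> and its restriction to the complement of
  \<open>z0\<close>.\<close>

lemma integrable_continuous_AE_circle:
  fixes f :: "complex \<Rightarrow> 'b :: {banach, second_countable_topology}"
  assumes "finite_measure \<nu>" "(\<lambda>z. z) \<in> borel_measurable \<nu>" "AE z in \<nu>. cmod z = 1"
    and f: "continuous_on UNIV f"
  shows "integrable \<nu> f"
proof -
  interpret finite_measure \<nu> by fact
  have "compact (f ` sphere 0 1)"
    using f by (intro compact_continuous_image) (auto intro: continuous_on_subset)
  then obtain B where B: "\<And>x. x \<in> sphere 0 1 \<Longrightarrow> norm (f x) \<le> B"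
    using compact_imp_bounded bounded_iff by (metis imageI)
  show ?thesis
  proof (rule integrable_const_bound)
    show "AE z in \<nu>. norm (f z) \<le> B"
      using assms(3) by eventually_elim (simp add: B)
    show "f \<in> borel_measurable \<nu>"
      using measurable_compose[OF assms(2) borel_measurable_continuous_onI[OF f]] .
  qed
qed

section \<open>The derivative at the atom, bounded below by orthogonality\<close>

text \<open>The hypothesis \<open>orth\<close> is orthogonality of \<open>p\<close> for the measure
  made of a mass \<beta> at \<open>z0\<close> and \<nu>. The test with \<open>q\<close> bounds
  \<open>\<beta> * P0\<close> by \<open>\<epsilon> * I1\<close>; the test with the quotient
  \<open>r\<close> bounds the square of \<open>I1\<close> by
  \<open>4 * \<beta> * |r(z0)| * P0\<close>. Squaring the first bound, inserting the second and
  cancelling one factor \<open>\<beta> * P0\<close> gives the claim.\<close>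

lemma orthogonal_pderiv_lower_bound:
  fixes \<nu> :: "complex measure" and p q :: "complex poly" and z0 :: complex
  assumes fin: "finite_measure \<nu>" and mass: "measure \<nu> (space \<nu>) \<le> 1"
    and meas: "(\<lambda>z. z) \<in> borel_measurable \<nu>"
    and circle: "AE z in \<nu>. cmod z = 1" and z0: "cmod z0 = 1"
    and far: "AE z in \<nu>. \<delta> \<le> cmod (z - z0)" and small: "AE z in \<nu>. cmod (poly q z) \<le> \<epsilon>"
    and pos: "\<delta> > 0" "\<beta> > 0" "\<epsilon> > 0"
    and deg: "degree p \<le> n" "degree q < n" and q0: "poly q z0 = 1"
    and orth: "\<And>r. degree r < n \<Longrightarrow>
      \<beta> * (cnj (poly r z0) * poly p z0) + (LINT z|\<nu>. cnj (poly r z) * poly p z) = 0"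
    and eps: "\<epsilon>\<^sup>2 \<le> \<beta> * \<delta> / 4"
  shows "\<beta> * cmod (poly p z0)
      \<le> 4 * \<epsilon>\<^sup>2 * cmod (poly (pderiv p) z0 - poly p z0 * poly (pderiv q) z0)"
proof -
  interpret finite_measure \<nu> by fact
  note int = integrable_continuous_AE_circle[OF fin meas circle]
  define P0 where "P0 = cmod (poly p z0)"
  define I1 where "I1 = (LINT z|\<nu>. cmod (poly p z))"
  define I2 where "I2 = (LINT z|\<nu>. (cmod (poly p z))\<^sup>2)"
  have i1: "integrable \<nu> (\<lambda>z. cmod (poly p z))" and i2: "integrable \<nu> (\<lambda>z. (cmod (poly p z))\<^sup>2)"
    by (intro int continuous_intros)+
  have I12: "I1\<^sup>2 \<le> I2"
    unfolding I1_def I2_def using i1 i2 mass by (rule square_integral_le)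
  have I1: "I1 \<ge> 0"
    by (simp add: I1_def)
  have "\<beta> * poly p z0 = - (LINT z|\<nu>. cnj (poly q z) * poly p z)"
    using orth[OF deg(2)] by (simp add: q0 eq_neg_iff_add_eq_0)
  then have "\<beta> * P0 = cmod (LINT z|\<nu>. cnj (poly q z) * poly p z)"
    using pos(2) by (metis P0_def abs_of_pos norm_minus_cancel norm_mult norm_of_real)
  also have "\<dots> \<le> (LINT z|\<nu>. cmod (cnj (poly q z) * poly p z))"
    by (rule integral_norm_bound)
  also have "\<dots> \<le> (LINT z|\<nu>. \<epsilon> * cmod (poly p z))"
  proof (rule integral_mono_AE)
    show "AE z in \<nu>. cmod (cnj (poly q z) * poly p z) \<le> \<epsilon> * cmod (poly p z)"
      using small by eventually_elim (simp add: norm_mult mult_right_mono)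
  qed (intro int continuous_intros)+
  finally have P0: "\<beta> * P0 \<le> \<epsilon> * I1"
    by (simp add: I1_def)

  \<comment> \<open>Subtracting this multiple of \<open>q\<close> makes \<open>s\<close> vanish at
    \<open>z0\<close>; dividing by \<open>z - z0\<close> then lowers the degree below
    \<open>n\<close>, so \<open>r\<close> is an admissible test polynomial.\<close>
  define s where "s = p - smult (poly p z0) q"
  have "poly s z0 = 0"
    by (simp add: s_def q0)
  then obtain r where r: "s = [:-z0, 1:] * r"
    by (auto simp: poly_eq_0_iff_dvd)
  have "degree r < n"
  proof (cases "r = 0")
    case False
    have "degree s \<le> n"
      unfolding s_def using deg
      by (intro degree_diff_le) (auto intro: order.trans[OF degree_smult_le])
    moreover have "degree s = Suc (degree r)"
      unfolding r using False by (subst degree_mult_eq) auto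
    ultimately show ?thesis
      by simp
  qed (use deg in simp)
  then have orth_r: "\<beta> * (cnj (poly r z0) * poly p z0) = - (LINT z|\<nu>. cnj (poly r z) * poly p z)"
    using orth by (simp add: eq_neg_iff_add_eq_0)
  have r0: "poly r z0 = poly (pderiv p) z0 - poly p z0 * poly (pderiv q) z0"
  proof -
    have "poly r z0 = poly (pderiv s) z0"
      unfolding r pderiv_mult by (simp add: pderiv_pCons)
    then show ?thesis
      by (simp add: s_def pderiv_diff pderiv_smult)
  qed
  have ir: "integrable \<nu> (\<lambda>z. cnj z0 * (cnj (poly r z) * poly p z))"
    by (intro int continuous_intros)
  \<comment> \<open>With \<open>u = z * cnj z0\<close> one has \<open>z - z0 = z0 * (u - 1)\<close>,
    so \<open>cnj z0 * cnj (poly r z)\<close> equals \<open>k * cnj (poly s z)\<close> for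
    \<open>k = 1 / (cnj u - 1)\<close>. The part of \<open>s\<close> from \<open>p\<close>
    contributes exactly \<open>-|p|^2 / 2\<close>; the part from \<open>q\<close> is an error,
    controlled by \<open>|k| \<le> 1 / \<delta>\<close>.\<close>
  have bound: "AE z in \<nu>. Re (cnj z0 * (cnj (poly r z) * poly p z))
      \<le> - (1/2) * (cmod (poly p z))\<^sup>2 + P0 * \<epsilon> / \<delta> * cmod (poly p z)"
    using circle far small
  proof eventually_elim
    fix z assume z: "cmod z = 1" "\<delta> \<le> cmod (z - z0)" "cmod (poly q z) \<le> \<epsilon>"
    define u where "u = z * cnj z0"
    define k where "k = 1 / (cnj u - 1)"
    have zz: "z0 * cnj z0 = 1"
      using z0 by (simp add: complex_norm_square[symmetric])
    have zz0: "z - z0 = z0 * (u - 1)"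
      using zz by (simp add: u_def algebra_simps)
    have u: "cmod u = 1" "\<delta> \<le> cmod (u - 1)"
      using z z0 zz0 by (auto simp: u_def norm_mult)
    have u1: "u \<noteq> 1"
      using u(2) pos(1) by auto
    then have u1': "cnj u \<noteq> 1"
      by (metis complex_cnj_cnj complex_cnj_one)
    have k: "cmod k \<le> 1 / \<delta>"
    proof -
      have "cmod (cnj u - 1) = cmod (u - 1)"
        by (metis complex_cnj_diff complex_cnj_one complex_mod_cnj)
      then show ?thesis
        using u(2) pos(1) by (simp add: k_def norm_divide frac_le)
    qed
    have "poly s z = (z - z0) * poly r z"
      by (simp add: r algebra_simps)
    then have "cnj (poly s z) = cnj z0 * (cnj u - 1) * cnj (poly r z)"
      by (simp add: zz0)
    then have "cnj z0 * cnj (poly r z) = k * cnj (poly s z)"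
      using u1' by (simp add: k_def field_simps)
    then have "cnj z0 * (cnj (poly r z) * poly p z) = k * cnj (poly s z) * poly p z"
      by (simp add: mult.assoc[symmetric])
    also have "\<dots> = k * (poly p z * cnj (poly p z))
        - k * cnj (poly p z0) * cnj (poly q z) * poly p z"
      by (simp add: s_def algebra_simps)
    also have "poly p z * cnj (poly p z) = of_real ((cmod (poly p z))\<^sup>2)"
      by (rule complex_norm_square[symmetric])
    finally have *: "Re (cnj z0 * (cnj (poly r z) * poly p z))
        = Re k * (cmod (poly p z))\<^sup>2 - Re (k * cnj (poly p z0) * cnj (poly q z) * poly p z)"
      by (simp del: of_real_power)
    have **: "Re k = - (1/2)"
      unfolding k_def using Re_one_over_cnj_minus_one[OF u(1) u1] by simp
    have "- Re (k * cnj (poly p z0) * cnj (poly q z) * poly p z)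
        \<le> cmod (k * cnj (poly p z0) * cnj (poly q z) * poly p z)"
      by (metis abs_Re_le_cmod abs_le_D2)
    also have "\<dots> = cmod k * P0 * cmod (poly q z) * cmod (poly p z)"
      by (simp add: norm_mult P0_def)
    also have "\<dots> \<le> 1 / \<delta> * P0 * \<epsilon> * cmod (poly p z)"
      using k z(3) pos by (intro mult_mono) (auto simp: P0_def)
    also have "\<dots> = P0 * \<epsilon> / \<delta> * cmod (poly p z)"
      by simp
    finally show "Re (cnj z0 * (cnj (poly r z) * poly p z))
        \<le> - (1/2) * (cmod (poly p z))\<^sup>2 + P0 * \<epsilon> / \<delta> * cmod (poly p z)"
      unfolding * ** by linarith
  qed
  have "- (\<beta> * Re (cnj z0 * (cnj (poly r z0) * poly p z0)))
      = Re (cnj z0 * (- (\<beta> * (cnj (poly r z0) * poly p z0))))"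
    by (simp add: algebra_simps)
  also have "\<dots> = Re (LINT z|\<nu>. cnj z0 * (cnj (poly r z) * poly p z))"
    by (simp add: orth_r)
  also have "\<dots> = (LINT z|\<nu>. Re (cnj z0 * (cnj (poly r z) * poly p z)))"
    using ir by (rule integral_Re[symmetric])
  also have "\<dots> \<le> (LINT z|\<nu>. - (1/2) * (cmod (poly p z))\<^sup>2 + P0 * \<epsilon> / \<delta> * cmod (poly p z))"
    using ir i1 i2 bound by (intro integral_mono_AE integrable_Re) auto
  also have "\<dots> = - (1/2) * I2 + P0 * \<epsilon> / \<delta> * I1"
    using i1 i2 by (simp add: I1_def I2_def)
  finally have A: "I2 / 2 - P0 * \<epsilon> / \<delta> * I1 \<le> \<beta> * Re (cnj z0 * (cnj (poly r z0) * poly p z0))"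
    by simp
  \<comment> \<open>The error term is absorbed: \<open>P0 \<le> \<epsilon> * I1 / \<beta>\<close>
    and \<open>eps\<close> bound it by a quarter of the square of \<open>I1\<close>, whereas
    \<open>I2 / 2\<close> is at least half of that square.\<close>
  have "P0 * \<epsilon> / \<delta> * I1 = \<beta> * P0 * (\<epsilon> / (\<beta> * \<delta>) * I1)"
    using pos by (simp add: field_simps)
  also have "\<dots> \<le> \<epsilon> * I1 * (\<epsilon> / (\<beta> * \<delta>) * I1)"
    using P0 I1 pos by (intro mult_right_mono) auto
  also have "\<dots> = \<epsilon>\<^sup>2 / (\<beta> * \<delta>) * I1\<^sup>2"
    by (simp add: power2_eq_square)
  also have "\<dots> \<le> 1 / 4 * I1\<^sup>2"
    using eps pos by (intro mult_right_mono) (auto simp: field_simps)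
  finally have "I1\<^sup>2 / 4 \<le> I2 / 2 - P0 * \<epsilon> / \<delta> * I1"
    using I12 by simp
  also have "\<dots> \<le> \<beta> * cmod (cnj z0 * (cnj (poly r z0) * poly p z0))"
    using A complex_Re_le_cmod pos(2) by (meson mult_left_mono less_imp_le order_trans)
  also have "\<dots> = \<beta> * cmod (poly r z0) * P0"
    by (simp add: norm_mult z0 P0_def)
  finally have B: "I1\<^sup>2 \<le> 4 * (\<beta> * cmod (poly r z0) * P0)"
    by simp
  have "\<beta> * P0 * (\<beta> * P0) \<le> \<epsilon> * I1 * (\<epsilon> * I1)"
    using pos I1 by (intro mult_mono[OF P0 P0]) (auto simp: P0_def)
  also have "\<dots> = \<epsilon>\<^sup>2 * I1\<^sup>2"
    by (simp add: power2_eq_square)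
  also have "\<dots> \<le> \<epsilon>\<^sup>2 * (4 * (\<beta> * cmod (poly r z0) * P0))"
    using B by (intro mult_left_mono) auto
  finally have "(\<beta> * P0) * (\<beta> * P0) \<le> (\<beta> * P0) * (4 * \<epsilon>\<^sup>2 * cmod (poly r z0))"
    by (simp add: algebra_simps)
  \<comment> \<open>For \<open>P0 = 0\<close> the claim holds trivially, as its right-hand side is
    nonnegative.\<close>
  then have "\<beta> * P0 \<le> 4 * \<epsilon>\<^sup>2 * cmod (poly r z0)" if "P0 \<noteq> 0"
    using that pos(2) by (subst (asm) mult_le_cancel_left_pos) (auto simp: P0_def)
  then show ?thesis
    unfolding r0[symmetric] P0_def[symmetric] by fastforce
qed

section \<open>Isolated points of the support as atoms\<close>

lemma circle_prob_measureD:
  assumes "circle_prob_measure \<mu>"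
  shows "prob_space \<mu>" "space \<mu> = sphere 0 1" "\<And>U. open U \<Longrightarrow> U \<inter> space \<mu> \<in> sets \<mu>"
    and "\<And>z. z \<in> space \<mu> \<Longrightarrow> {z} \<in> sets \<mu>" "(\<lambda>z. z) \<in> borel_measurable \<mu>"
proof -
  show "prob_space \<mu>"
    using assms by (simp add: circle_prob_measure_def)
  have sets: "sets \<mu> = sets (restrict_space borel (sphere 0 1))"
    using assms by (simp add: circle_prob_measure_def)
  show space: "space \<mu> = sphere 0 1"
    using sets_eq_imp_space_eq[OF sets] by (simp add: space_restrict_space)
  have inter: "A \<inter> space \<mu> \<in> sets \<mu>" if "A \<in> sets borel" for A
    using that unfolding sets sets_restrict_space space by (auto simp: Int_commute)
  then show "U \<inter> space \<mu> \<in> sets \<mu>" if "open U" for U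
    using that by simp
  show "{z} \<in> sets \<mu>" if "z \<in> space \<mu>" for z
    using inter[of "{z}"] that by simp
  show "(\<lambda>z. z) \<in> borel_measurable \<mu>"
    by (simp add: measurable_cong_sets[OF sets refl] measurable_restrict_space1)
qed

text \<open>The complement of the support is a union of null open sets, hence null because
  Lindelof's theorem makes the union countable. A neighbourhood \<open>T\<close> meeting the support
  only in \<open>z0\<close> thus has all its mass at \<open>z0\<close>, and this mass is positive
  since \<open>z0\<close> lies in the support.\<close>

lemma isolated_in_measure_supp:
  assumes \<mu>: "circle_prob_measure \<mu>" and iso: "z0 isolated_in measure_supp \<mu>"
  shows "measure \<mu> {z0} > 0"
    and "\<exists>\<delta>>0. AE z in \<mu>. z \<noteq> z0 \<longrightarrow> \<delta> \<le> cmod (z - z0)"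
proof -
  note [simp] = circle_prob_measureD(3)[OF \<mu>]
  interpret prob_space \<mu>
    by (rule circle_prob_measureD(1)[OF \<mu>])
  obtain T where T: "open T" "T \<inter> measure_supp \<mu> = {z0}"
    using iso by (auto simp: isolated_in_def)
  define F where "F = {U. open U \<and> emeasure \<mu> (U \<inter> space \<mu>) = 0}"
  have "\<And>U. U \<in> F \<Longrightarrow> open U"
    by (simp add: F_def)
  then obtain F' where F': "F' \<subseteq> F" "countable F'" "\<Union>F' = \<Union>F"
    by (rule Lindelof)
  have "(\<Union>U\<in>F'. U \<inter> space \<mu>) \<in> null_sets \<mu>"
    using F' by (intro null_sets_UN') (auto simp: F_def null_sets_def)
  then have "AE z in \<mu>. z \<notin> (\<Union>U\<in>F'. U \<inter> space \<mu>)"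
    by (rule AE_not_in)
  then have AE: "AE z in \<mu>. z \<in> T \<longrightarrow> z = z0"
    using AE_space
  proof eventually_elim
    case (elim z)
    then have "z \<notin> \<Union>F"
      using F'(3) by auto
    then have "z \<in> measure_supp \<mu>"
      using elim by (auto simp: measure_supp_def F_def zero_less_iff_neq_zero)
    then show ?case
      using T(2) by auto
  qed
  have z0: "z0 \<in> T" "z0 \<in> measure_supp \<mu>"
    using T(2) by auto
  then have "z0 \<in> space \<mu>"
    by (simp add: measure_supp_def)
  then have sing: "{z0} \<in> sets \<mu>"
    by (rule circle_prob_measureD(4)[OF \<mu>])
  have "emeasure \<mu> (T \<inter> space \<mu>) > 0"
    using z0 T(1) by (auto simp: measure_supp_def)
  moreover have "AE z in \<mu>. z \<in> T \<inter> space \<mu> \<longleftrightarrow> z \<in> {z0}"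
    using AE AE_space by eventually_elim (use z0 in auto)
  then have "emeasure \<mu> (T \<inter> space \<mu>) = emeasure \<mu> {z0}"
    using T(1) sing by (intro emeasure_eq_AE) auto
  ultimately show "measure \<mu> {z0} > 0"
    by (simp add: emeasure_eq_measure)
  obtain \<delta> where \<delta>: "\<delta> > 0" "ball z0 \<delta> \<subseteq> T"
    using T(1) z0(1) by (meson open_contains_ball)
  have "AE z in \<mu>. z \<noteq> z0 \<longrightarrow> \<delta> \<le> cmod (z - z0)"
    using AE by eventually_elim (use \<delta>(2) in \<open>force simp: dist_norm norm_minus_commute subset_iff\<close>)
  with \<delta>(1) show "\<exists>\<delta>>0. AE z in \<mu>. z \<noteq> z0 \<longrightarrow> \<delta> \<le> cmod (z - z0)"
    by blast
qed

text \<open>This brings orthogonality for \<mu> into the form, atom plus remainder, required by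
  \<open>orthogonal_pderiv_lower_bound\<close>.\<close>

lemma (in finite_measure) integral_split_singleton:
  fixes f :: "'a \<Rightarrow> 'b :: {banach, second_countable_topology}"
  assumes f: "integrable M f" and z0: "{z0} \<in> sets M"
  shows "integral\<^sup>L M f = measure M {z0} *\<^sub>R f z0
      + integral\<^sup>L (restrict_space M (space M - {z0})) f"
proof -
  have C: "space M - {z0} \<in> sets M"
    using z0 by auto
  have "integral\<^sup>L M f
      = (LINT z|M. indicator {z0} z *\<^sub>R f z0 + indicator (space M - {z0}) z *\<^sub>R f z)"
    by (intro Bochner_Integration.integral_cong) (auto simp: indicator_def)
  also have "\<dots> = (LINT z|M. indicator {z0} z *\<^sub>R f z0)
      + (LINT z|M. indicator (space M - {z0}) z *\<^sub>R f z)"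
    using f z0 C
    by (intro Bochner_Integration.integral_add integrable_mult_indicator
        integrable_scaleR_left integrable_real_indicator) (auto simp: less_top[symmetric])
  also have "(LINT z|M. indicator (space M - {z0}) z *\<^sub>R f z)
      = integral\<^sup>L (restrict_space M (space M - {z0})) f"
    using C by (subst integral_restrict_space) auto
  also have "(LINT z|M. indicator {z0} z *\<^sub>R f z0) = measure M {z0} *\<^sub>R f z0"
    using z0 by (subst integral_scaleR_left)
      (auto simp: sets.Int_space_eq2 less_top[symmetric] intro!: integrable_real_indicator)
  finally show ?thesis .
qed

section \<open>Zeros near the atom for large degree\<close>

text \<open>The test polynomial \<open>((1 + cnj z0 * z) / 2) ^ (n - 1)\<close> peaks at \<open>z0\<close> and is
  exponentially small on the rest of the support, by the parallelogram law
  \<open>|1 + u|\<^sup>2 + |1 - u|\<^sup>2 = 4\<close> on the unit circle.\<close>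

lemma exponentially_close_zeros:
  fixes \<mu> :: "complex measure" and p :: "nat \<Rightarrow> complex poly"
  assumes \<mu>: "circle_prob_measure \<mu>" and iso: "z0 isolated_in measure_supp \<mu>"
    and p: "\<And>n. monic_orthogonal \<mu> n (p n)"
  shows "\<exists>\<rho>. 0 < \<rho> \<and> \<rho> < 1 \<and>
    (\<forall>\<^sub>F n in sequentially. \<exists>w. poly (p n) w = 0 \<and> cmod (w - z0) \<le> \<rho> ^ (n - 1))"
proof -
  note D = circle_prob_measureD[OF \<mu>]
  interpret prob_space \<mu>
    by (rule D(1))
  define \<beta> where "\<beta> = measure \<mu> {z0}"
  have \<beta>: "\<beta> > 0"
    unfolding \<beta>_def using isolated_in_measure_supp(1)[OF \<mu> iso] .
  obtain \<delta>0 where \<delta>0: "\<delta>0 > 0" "AE z in \<mu>. z \<noteq> z0 \<longrightarrow> \<delta>0 \<le> cmod (z - z0)"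
    using isolated_in_measure_supp(2)[OF \<mu> iso] by blast
  \<comment> \<open>The cap at 1 keeps \<open>1 - \<delta>^2 / 4\<close> positive, so that \<rho>
    lies strictly between 0 and 1.\<close>
  define \<delta> where "\<delta> = min 1 \<delta>0"
  have \<delta>: "0 < \<delta>" "\<delta> \<le> 1" "AE z in \<mu>. z \<noteq> z0 \<longrightarrow> \<delta> \<le> cmod (z - z0)"
    using \<delta>0 by (auto simp: \<delta>_def elim!: eventually_mono)
  have z0_space: "z0 \<in> space \<mu>"
    using iso by (auto simp: isolated_in_def measure_supp_def)
  then have z0: "cmod z0 = 1" and sing: "{z0} \<in> sets \<mu>"
    using D by auto
  have zz: "cnj z0 * z0 = 1"
    using z0 by (simp add: complex_norm_square[symmetric] mult.commute)
  define \<rho> where "\<rho> = sqrt (1 - \<delta>\<^sup>2 / 4)"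
  have "0 < \<delta>\<^sup>2" "\<delta>\<^sup>2 \<le> 1"
    using \<delta> by (auto simp: power_le_one)
  then have \<rho>: "0 < \<rho>" "\<rho> < 1"
    by (auto simp: \<rho>_def)
  define \<nu> where "\<nu> = restrict_space \<mu> (space \<mu> - {z0})"
  have C: "space \<mu> - {z0} \<in> sets \<mu>"
    using sing by auto
  have fin: "finite_measure \<nu>"
    unfolding \<nu>_def using C by (intro finite_measure_restrict_space) unfold_locales
  have mass: "measure \<nu> (space \<nu>) \<le> 1"
    unfolding \<nu>_def using C by (simp add: space_restrict_space measure_restrict_space prob_le_1)
  have meas: "(\<lambda>z. z) \<in> borel_measurable \<nu>"
    unfolding \<nu>_def using D(5) by (rule measurable_restrict_space1)
  have AE_\<nu>: "(AE z in \<nu>. P z) \<longleftrightarrow> (AE z in \<mu>. z \<in> space \<mu> - {z0} \<longrightarrow> P z)" for P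
    unfolding \<nu>_def using C by (intro AE_restrict_space_iff) auto
  have circle_\<mu>: "AE z in \<mu>. cmod z = 1"
    using AE_space by eventually_elim (simp add: D(2))
  then have circle: "AE z in \<nu>. cmod z = 1"
    by (auto simp: AE_\<nu> elim: eventually_mono)
  have far: "AE z in \<nu>. \<delta> \<le> cmod (z - z0)"
    using \<delta>(3) by (auto simp: AE_\<nu> elim: eventually_mono)
  define h where "h = [:1/2, cnj z0 / 2:]"
  have h0: "poly h z0 = 1"
    using zz by (simp add: h_def mult.commute)
  have h: "AE z in \<nu>. cmod (poly h z) \<le> \<rho>"
    using circle far
  proof eventually_elim
    case (elim z)
    define u where "u = cnj z0 * z"
    have "u - 1 = cnj z0 * (z - z0)"
      using zz by (simp add: u_def algebra_simps)
    then have u: "cmod u = 1" "\<delta> \<le> cmod (u - 1)"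
      using elim z0 by (auto simp: u_def norm_mult)
    have "(Re u)\<^sup>2 + (Im u)\<^sup>2 = 1"
      using u(1) cmod_power2[of u] by simp
    then have "(cmod (u + 1))\<^sup>2 + (cmod (u - 1))\<^sup>2 = 4"
      unfolding cmod_power2 by (simp add: power2_eq_square algebra_simps)
    moreover have "\<delta>\<^sup>2 \<le> (cmod (u - 1))\<^sup>2"
      using u(2) \<delta>(1) by (intro power_mono) auto
    moreover have "poly h z = (u + 1) / 2"
      by (simp add: h_def u_def field_simps)
    then have "(cmod (poly h z))\<^sup>2 = (cmod (u + 1))\<^sup>2 / 4"
      by (simp only: norm_divide power_divide norm_numeral) simp
    ultimately have "(cmod (poly h z))\<^sup>2 \<le> 1 - \<delta>\<^sup>2 / 4"
      by simp
    then show ?case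
      unfolding \<rho>_def by (rule real_le_rsqrt)
  qed
  \<comment> \<open>Condition \<open>x1\<close> is the smallness needed for the lower bound with
    \<open>\<epsilon> = x\<close>; \<open>x2\<close> is what later absorbs the term from the
    derivative of \<open>q\<close>. Both hold for large \<open>n\<close>.\<close>
  have close: "\<exists>w. poly (p n) w = 0 \<and> cmod (w - z0) \<le> \<rho> ^ (n - 1)"
    if n: "n \<ge> 1" and x1: "(\<rho> ^ (n - 1))\<^sup>2 \<le> \<beta> * \<delta> / 4"
      and x2: "2 * real n * (\<rho> ^ (n - 1))\<^sup>2 + 4 * real n * \<rho> ^ (n - 1) \<le> \<beta>" for n
  proof -
    define x where "x = \<rho> ^ (n - 1)"
    have x: "x > 0"
      using \<rho> by (simp add: x_def)
    \<comment> \<open>The exponent \<open>n - 1\<close> keeps the degree strictly below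
      \<open>n\<close>, as the orthogonality relation demands.\<close>
    define q where "q = h ^ (n - 1)"
    let ?P = "poly (p n) z0" and ?P' = "poly (pderiv (p n)) z0" and ?q' = "poly (pderiv q) z0"
    have deg: "degree (p n) = n"
      using p by (simp add: monic_orthogonal_def)
    have "degree q \<le> degree h * (n - 1)"
      unfolding q_def by (rule degree_power_le)
    also have "\<dots> \<le> 1 * (n - 1)"
      by (intro mult_right_mono) (auto simp: h_def)
    finally have degq: "degree q < n"
      using n by simp
    have orth: "\<beta> * (cnj (poly r z0) * ?P) + (LINT z|\<nu>. cnj (poly r z) * poly (p n) z) = 0"
      if "degree r < n" for r
    proof -
      have "integrable \<mu> (\<lambda>z. cnj (poly r z) * poly (p n) z)"
        by (intro integrable_continuous_AE_circle[OF _ D(5) circle_\<mu>] continuous_intros) unfold_locales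
      from integral_split_singleton[OF this sing] show ?thesis
        using p[of n] that by (simp add: monic_orthogonal_def \<beta>_def \<nu>_def scaleR_conv_of_real)
    qed
    have small: "AE z in \<nu>. cmod (poly q z) \<le> x"
      using h by eventually_elim (simp add: q_def x_def poly_power norm_power power_mono)
    have A: "\<beta> * cmod ?P \<le> 4 * x\<^sup>2 * cmod (?P' - ?P * ?q')"
      by (rule orthogonal_pderiv_lower_bound[OF fin mass meas circle z0 far small \<delta>(1) \<beta> x _ degq _ orth])
        (use x1 deg h0 in \<open>auto simp: q_def x_def poly_power\<close>)
    obtain w where w: "poly (p n) w = 0" "cmod ?P' * cmod (z0 - w) \<le> n * cmod ?P"
      using ex_root_near[of "p n" z0] n deg by auto
    have "?q' = of_nat (n - 1) * cnj z0 / 2"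
      by (simp add: q_def pderiv_power poly_power h0 pderiv_pCons) (simp add: h_def pderiv_pCons)
    then have "cmod ?q' = real (n - 1) / 2"
      by (simp only: norm_mult norm_divide complex_mod_cnj z0 norm_of_nat norm_numeral mult_1_right)
    then have q': "cmod ?q' \<le> n / 2"
      by simp
    have "cmod (?P' - ?P * ?q') \<le> cmod ?P' + cmod ?P * cmod ?q'"
      by (metis norm_mult norm_triangle_ineq4)
    also have "\<dots> \<le> cmod ?P' + cmod ?P * (n / 2)"
      using q' by (intro add_left_mono mult_left_mono) auto
    finally have "\<beta> * cmod ?P \<le> 4 * x\<^sup>2 * (cmod ?P' + cmod ?P * (n / 2))"
      using A by (meson mult_left_mono order_trans zero_le_power2 zero_le_mult_iff zero_le_numeral)
    \<comment> \<open>Subtracting this from the preceding bound cancels the terms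
      \<open>2 * n * x^2 * |p(z0)|\<close> and leaves \<open>n * |p(z0)| \<le> x * |p'(z0)|\<close>
      up to the factor \<open>4 * x\<close>.\<close>
    moreover have "(2 * real n * x\<^sup>2 + 4 * real n * x) * cmod ?P \<le> \<beta> * cmod ?P"
      using x2 by (intro mult_right_mono) (auto simp: x_def)
    ultimately have "4 * x * (n * cmod ?P) \<le> 4 * x * (x * cmod ?P')"
      by (simp add: power2_eq_square algebra_simps)
    then have B: "n * cmod ?P \<le> x * cmod ?P'"
      using x by (subst (asm) mult_le_cancel_left_pos) auto
    show ?thesis
    \<comment> \<open>If \<open>p\<close> vanishes at \<open>z0\<close>, then \<open>z0\<close> is
      itself the required zero. Otherwise \<open>B\<close> forces \<open>p'(z0)\<close> to be
      nonzero, so it can be cancelled.\<close>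
    proof (cases "?P = 0")
      case True
      then show ?thesis
        using x by (intro exI[of _ z0]) (simp add: x_def)
    next
      case False
      have "cmod ?P' * cmod (z0 - w) \<le> cmod ?P' * x"
        using w(2) B by (simp add: mult.commute)
      moreover have "0 < n * cmod ?P"
        using False n by simp
      then have "0 < x * cmod ?P'"
        using B by (rule less_le_trans)
      then have "cmod ?P' > 0"
        using x by (rule zero_less_mult_pos)
      ultimately have "cmod (z0 - w) \<le> x"
        by (subst (asm) mult_le_cancel_left_pos)
      then show ?thesis
        using w(1) by (auto simp: x_def norm_minus_commute)
    qed
  qed
  have "((\<lambda>n. (\<rho> ^ (n - 1))\<^sup>2) \<longlongrightarrow> 0) sequentially"
    using \<rho> by real_asymp
  then have "\<forall>\<^sub>F n in sequentially. (\<rho> ^ (n - 1))\<^sup>2 < \<beta> * \<delta> / 4"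
    by (rule order_tendstoD) (use \<beta> \<delta> in simp)
  moreover have "((\<lambda>n. 2 * real n * (\<rho> ^ (n - 1))\<^sup>2 + 4 * real n * \<rho> ^ (n - 1)) \<longlongrightarrow> 0) sequentially"
    using \<rho> by real_asymp
  then have "\<forall>\<^sub>F n in sequentially. 2 * real n * (\<rho> ^ (n - 1))\<^sup>2 + 4 * real n * \<rho> ^ (n - 1) < \<beta>"
    by (rule order_tendstoD) (use \<beta> in simp)
  ultimately have "\<forall>\<^sub>F n in sequentially. \<exists>w. poly (p n) w = 0 \<and> cmod (w - z0) \<le> \<rho> ^ (n - 1)"
    using eventually_ge_at_top[of 1] by eventually_elim (rule close; simp)
  then show ?thesis
    using \<rho> by blast
qed

section \<open>From large degrees to all degrees\<close>

theorem theorem4p4: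
  fixes \<mu> :: "complex measure" and z0 :: complex
  assumes "nontrivial_circle_measure \<mu>"
    and "z0 isolated_in measure_supp \<mu>"
  shows "\<exists>C a :: real. C > 0 \<and> a > 0 \<and> (\<exists>z :: nat \<Rightarrow> complex. \<forall>n \<ge> 1.
           poly (opuc \<mu> n) (z n) = 0 \<and>
           cmod (z n - z0) \<le> C * exp (- a * \<bar>real n\<bar>))"
proof -
  note orth = monic_orthogonal_opuc[OF assms(1)]
  have "circle_prob_measure \<mu>"
    using assms(1) by (simp add: nontrivial_circle_measure_def)
  then obtain \<rho> N where \<rho>: "0 < \<rho>" "\<rho> < 1"
    and N: "\<And>n. n \<ge> N \<Longrightarrow> \<exists>w. poly (opuc \<mu> n) w = 0 \<and> cmod (w - z0) \<le> \<rho> ^ (n - 1)"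
    using exponentially_close_zeros[OF _ assms(2) orth] by (auto simp: eventually_sequentially)
  have root: "\<exists>w. poly (opuc \<mu> n) w = 0" if "n \<ge> 1" for n
    using ex_root_near[of "opuc \<mu> n"] orth[of n] that by (auto simp: monic_orthogonal_def)
  \<comment> \<open>The premise \<open>n \<ge> 1\<close> makes a choice possible for every
    \<open>n\<close>: the polynomial of degree 0 is the constant 1 and has no zero.\<close>
  have "\<exists>w. n \<ge> 1 \<longrightarrow> poly (opuc \<mu> n) w = 0 \<and> (n \<ge> N \<longrightarrow> cmod (w - z0) \<le> \<rho> ^ (n - 1))" for n
    using N[of n] root[of n] by blast
  then obtain z where z: "\<And>n. n \<ge> 1 \<Longrightarrow> poly (opuc \<mu> n) (z n) = 0"
      "\<And>n. n \<ge> 1 \<Longrightarrow> n \<ge> N \<Longrightarrow> cmod (z n - z0) \<le> \<rho> ^ (n - 1)"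
    by metis
  define a where "a = - ln \<rho>"
  have a: "a > 0"
    using \<rho> by (simp add: a_def)
  have exp_a: "exp (- a * \<bar>real n\<bar>) = \<rho> ^ n" for n
    using \<rho> by (simp add: a_def exp_of_nat2_mult)
  \<comment> \<open>The term \<open>1 / \<rho>\<close> turns \<open>\<rho> ^ (n - 1)\<close> into
    \<open>\<rho> ^ n\<close>; the sum covers the finitely many degrees below \<open>N\<close>,
    where the chosen zero is arbitrary.\<close>
  define C where "C = 1 / \<rho> + (\<Sum>k<N. cmod (z k - z0) / \<rho> ^ k)"
  have S: "(\<Sum>k<N. cmod (z k - z0) / \<rho> ^ k) \<ge> 0"
    using \<rho> by (intro sum_nonneg) auto
  have C: "C > 0"
    using \<rho> S by (simp add: C_def add_pos_nonneg)
  have "cmod (z n - z0) \<le> C * \<rho> ^ n" if n: "n \<ge> 1" for n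
  proof (cases "n < N")
    case True
    then have "cmod (z n - z0) / \<rho> ^ n \<le> (\<Sum>k<N. cmod (z k - z0) / \<rho> ^ k)"
      using \<rho> by (intro member_le_sum) auto
    also have "\<dots> \<le> C"
      using \<rho> by (simp add: C_def)
    finally show ?thesis
      using \<rho> by (simp add: field_simps)
  next
    case False
    then have "cmod (z n - z0) \<le> \<rho> ^ (n - 1)"
      using z(2) n by simp
    also have "\<dots> = 1 / \<rho> * \<rho> ^ n"
      using \<rho> n by (simp add: power_eq_if)
    also have "\<dots> \<le> C * \<rho> ^ n"
      using \<rho> S by (intro mult_right_mono) (auto simp: C_def)
    finally show ?thesis .
  qed
  with z(1) have "\<forall>n\<ge>1. poly (opuc \<mu> n) (z n) = 0 \<and>
      cmod (z n - z0) \<le> C * exp (- a * \<bar>real n\<bar>)"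
    unfolding exp_a by blast
  with a C show ?thesis
    by blast
qed

end
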